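(* For every integer $k\ge 2$ let $(G^4_k,\boldsymbol c^4_k)$ be the EWMCP instance and $\mathscr C^4_k$ the coloring of $G^4_k$, of cardinality $k$, defined in the context, and let $\prec^4_k$ be any total order of the independent sets in $\mathscr C^4_k$. Then $$\frac{\mathrm{UB}_2(G^4_k,\boldsymbol c^4_k,\mathscr C^4_k,\prec^4_k)}{\mathrm{UB}_3(G^4_k,\boldsymbol c^4_k,k)}\to 2\quad\text{as } k\to+\infty .$$
   Context: An instance of the Edge-Weighted Maximum Clique Problem (EWMCP) is a pair $(G,\boldsymbol c)$ where $G=(V,E)$ is a finite simple undirected graph and $\boldsymbol c=(c_e)_{e\in E}$ is a vector of nonnegative integer edge-weights. For $u\in V$, $\delta(u)\subseteq E$ is the set of edges incident to $u$. A coloring $\mathscr C$ of the vertices of $G$ is a partition of $V$ into disjoint non-empty independent sets (sets of pairwise non-adjacent vertices). Second upper bound. Let $\prec$ be a (strict) total order on the coloring $\mathscr C$, and let $I(u)\in\mathscr C$ denote the unique member of $\mathscr C$ containing $u\in V$. For $u\in V$ set $$\sigma_u:=\sum_{I\in\mathscr C:\,I\prec I(u)}\max\{c_e: e=\{u,v\}\in\delta(u),\ v\in I\},$$ where the maximum is $0$ if no such edge exists. Then $$\mathrm{UB}_2(G,\boldsymbol c,\mathscr C,\prec):=\sum_{I\in\mathscr C}\max\{\sigma_u:u\in I\}.$$ Third upper bound. Let $k$ be an integer with $1\le k\le|V|$ that is an upper bound on the cardinality of every clique of $G$. For $u\in V$ and an integer $t\ge0$, $\delta_t(u)\subseteq\delta(u)$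 denotes any set of the $\min\{t,|\delta(u)|\}$ heaviest edges incident to $u$. Set $\eta_u:=\frac12\sum_{e\in\delta_{k-1}(u)}c_e$ for $u\in V$, and order the vertices as $\varphi(1),\dots,\varphi(|V|)$ with $\eta_{\varphi(1)}\ge\eta_{\varphi(2)}\ge\dots\ge\eta_{\varphi(|V|)}$ (ties broken arbitrarily). Then $$\mathrm{UB}_3(G,\boldsymbol c,k):=\sum_{j=1}^{k}\eta_{\varphi(j)}.$$ The instances. For every integer $k\ge2$, the vertex set $V^4_k$ of $G^4_k$ has $k(k-1)$ elements and is partitioned into $k$ independent sets, each of cardinality $k-1$; this partition is the coloring $\mathscr C^4_k$. For each $I\in\mathscr C^4_k$, the vertices of $I$ are labeled $v_{I,J}$ with $J\in\mathscr C^4_k\setminus\{I\}$ (one vertex per $J$). For every pair of distinct $I,J\in\mathscr C^4_k$, the vertices $v_{I,J}\in I$ and $v_{J,I}\in J$ are joined by an edge of weight $1$; these $\binom{k}{2}$ edges form a perfect matching of $V^4_k$. Every other pair of vertices lying in distinct independent sets of $\mathscr C^4_k$ is joined by an edge of weight $0$. There are no other edges. These weights define $\boldsymbol c^4_k$. *)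

theory Defs
  imports Complex_Main "HOL-Library.Disjoint_Sets"
begin

text \<open>Graphs are given by a vertex set and a set of two-element edges; edge weights are functions
  on sets of vertices, of which only the values on edges matter.\<close>

definition simple_graph :: "'a set \<Rightarrow> 'a set set \<Rightarrow> bool" where
  "simple_graph V E \<longleftrightarrow> finite V \<and> (\<forall>e\<in>E. \<exists>u\<in>V. \<exists>v\<in>V. u \<noteq> v \<and> e = {u, v})"

definition incident_edges :: "'a set set \<Rightarrow> 'a \<Rightarrow> 'a set set" where
  "incident_edges E u = {e \<in> E. u \<in> e}"

definition clique :: "'a set \<Rightarrow> 'a set set \<Rightarrow> 'a set \<Rightarrow> bool" where
  "clique V E K \<longleftrightarrow> K \<subseteq> V \<and> (\<forall>u\<in>K. \<forall>v\<in>K. u \<noteq> v \<longrightarrow> {u, v} \<in> E)"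

definition independent_set :: "'a set set \<Rightarrow> 'a set \<Rightarrow> bool" where
  "independent_set E I \<longleftrightarrow> (\<forall>u\<in>I. \<forall>v\<in>I. {u, v} \<notin> E)"

definition coloring :: "'a set \<Rightarrow> 'a set set \<Rightarrow> 'a set set \<Rightarrow> bool" where
  "coloring V E C \<longleftrightarrow> partition_on V C \<and> (\<forall>I\<in>C. independent_set E I)"

definition strict_total_order_on :: "'a set \<Rightarrow> ('a \<Rightarrow> 'a \<Rightarrow> bool) \<Rightarrow> bool" where
  "strict_total_order_on A prec \<longleftrightarrow> irreflp_on A prec \<and> transp_on A prec \<and> totalp_on A prec"


definition color_of :: "'a set set \<Rightarrow> 'a \<Rightarrow> 'a set" where
  "color_of C u = (THE I. I \<in> C \<and> u \<in> I)"

definition max_or_0 :: "nat set \<Rightarrow> nat" where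
  "max_or_0 A = (if A = {} then 0 else Max A)"

definition sigma ::
  "'a set set \<Rightarrow> ('a set \<Rightarrow> nat) \<Rightarrow> 'a set set \<Rightarrow> ('a set \<Rightarrow> 'a set \<Rightarrow> bool) \<Rightarrow> 'a \<Rightarrow> nat" where
  "sigma E c C prec u =
     (\<Sum>I\<in>{I \<in> C. prec I (color_of C u)}.
        max_or_0 {c e | e v. e = {u, v} \<and> e \<in> incident_edges E u \<and> v \<in> I})"

definition UB2 ::
  "'a set set \<Rightarrow> ('a set \<Rightarrow> nat) \<Rightarrow> 'a set set \<Rightarrow> ('a set \<Rightarrow> 'a set \<Rightarrow> bool) \<Rightarrow> nat" where
  "UB2 E c C prec = (\<Sum>I\<in>C. Max (sigma E c C prec ` I))"


text \<open>The third bound involves two arbitrary choices: a set \<open>D u\<close> of heaviest edges at every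
  vertex \<open>u\<close>, and an ordering \<open>\<phi>\<close> of the vertices. Both are explicit arguments below, so that
  statements can quantify over all admissible choices.\<close>

definition heaviest_edges ::
  "'a set set \<Rightarrow> ('a set \<Rightarrow> nat) \<Rightarrow> nat \<Rightarrow> 'a \<Rightarrow> 'a set set \<Rightarrow> bool" where
  "heaviest_edges E c t u S \<longleftrightarrow>
     S \<subseteq> incident_edges E u \<and> card S = min t (card (incident_edges E u)) \<and>
     (\<forall>e\<in>S. \<forall>f\<in>incident_edges E u - S. c f \<le> c e)"

definition eta :: "('a set \<Rightarrow> nat) \<Rightarrow> ('a \<Rightarrow> 'a set set) \<Rightarrow> 'a \<Rightarrow> real" where
  "eta c D u = 1 / 2 * (\<Sum>e\<in>D u. real (c e))"

definition descending_ordering :: "'a set \<Rightarrow> ('a \<Rightarrow> real) \<Rightarrow> (nat \<Rightarrow> 'a) \<Rightarrow> bool" where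
  "descending_ordering V h \<phi> \<longleftrightarrow>
     bij_betw \<phi> {1..card V} V \<and> antimono_on {1..card V} (\<lambda>j. h (\<phi> j))"

definition UB3_choice ::
  "'a set \<Rightarrow> 'a set set \<Rightarrow> ('a set \<Rightarrow> nat) \<Rightarrow> nat \<Rightarrow> ('a \<Rightarrow> 'a set set) \<Rightarrow> (nat \<Rightarrow> 'a) \<Rightarrow> bool" where
  "UB3_choice V E c k D \<phi> \<longleftrightarrow>
     (\<forall>u\<in>V. heaviest_edges E c (k - 1) u (D u)) \<and> descending_ordering V (eta c D) \<phi>"

definition UB3 ::
  "('a set \<Rightarrow> nat) \<Rightarrow> nat \<Rightarrow> ('a \<Rightarrow> 'a set set) \<Rightarrow> (nat \<Rightarrow> 'a) \<Rightarrow> real" where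
  "UB3 c k D \<phi> = (\<Sum>j = 1..k. eta c D (\<phi> j))"

text \<open>In a simple graph, admissible choices always exist.\<close>

lemma heaviest_edges_exist:
  assumes "simple_graph V E"
  shows "\<exists>S. heaviest_edges E c t u S"
proof -
  have "E \<subseteq> Pow V" and "finite V" using assms by (auto simp: simple_graph_def)
  then have fin: "finite (incident_edges E u)"
    by (auto simp: incident_edges_def intro: finite_subset)
  show ?thesis
  proof (induction t)
    case 0
    show ?case by (intro exI[of _ "{}"]) (simp add: heaviest_edges_def)
  next
    case (Suc t)
    then obtain S where S: "heaviest_edges E c t u S" by blast
    let ?R = "incident_edges E u - S"
    have sub: "S \<subseteq> incident_edges E u" using S by (simp add: heaviest_edges_def)
    then have finS: "finite S" using fin finite_subset by blast
    show ?case
    proof (cases "?R = {}")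
      case True
      then have "S = incident_edges E u" using sub by auto
      then show ?thesis using S by (intro exI[of _ S]) (auto simp: heaviest_edges_def)
    next
      case False
      have finR: "finite ?R" using fin by simp
      then have "Max (c ` ?R) \<in> c ` ?R" using False by (intro Max_in) auto
      then obtain e where e: "e \<in> ?R" "c e = Max (c ` ?R)" by auto
      then have emax: "\<forall>f\<in>?R. c f \<le> c e" using finR by simp
      have "card S < card (incident_edges E u)"
        using False sub fin by (intro psubset_card_mono) auto
      then have "card (insert e S) = min (Suc t) (card (incident_edges E u))"
        using S e finS by (auto simp: heaviest_edges_def)
      then have "heaviest_edges E c (Suc t) u (insert e S)"
        using S e emax by (auto simp: heaviest_edges_def)
      then show ?thesis by blast
    qed
  qed
qed

lemma descending_ordering_exists:
  assumes "finite V"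
  shows "\<exists>\<phi>. descending_ordering V h \<phi>"
proof -
  obtain ys where ys: "set ys = V" "distinct ys"
    using finite_distinct_list[OF assms] by blast
  define xs where "xs = sort_key (\<lambda>v. - h v) ys"
  have xs: "set xs = V" "distinct xs" "length xs = card V"
    using ys distinct_card[of ys] by (auto simp: xs_def)
  have sorted: "sorted (map (\<lambda>v. - h v) xs)" by (simp add: xs_def)
  define \<phi> where "\<phi> j = xs ! (j - 1)" for j
  have "bij_betw ((!) xs) {..<card V} V"
    by (rule bij_betw_nth) (use xs in auto)
  moreover have "bij_betw (\<lambda>j. j - 1) {1..card V} {..<card V}"
    by (rule bij_betwI[where g = Suc]) auto
  ultimately have "bij_betw ((!) xs \<circ> (\<lambda>j. j - 1)) {1..card V} V"
    by (rule bij_betw_trans[rotated])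
  then have "bij_betw \<phi> {1..card V} V"
    by (simp only: \<phi>_def[abs_def] comp_def)
  moreover have "antimono_on {1..card V} (\<lambda>j. h (\<phi> j))"
  proof (rule monotone_onI)
    fix i j assume ij: "i \<in> {1..card V}" "j \<in> {1..card V}" "i \<le> j"
    then have "i - 1 \<le> j - 1" "j - 1 < length xs" using xs(3) by auto
    then have "- h (xs ! (i - 1)) \<le> - h (xs ! (j - 1))"
      using sorted_nth_mono[OF sorted, of "i - 1" "j - 1"] by simp
    then show "h (\<phi> j) \<le> h (\<phi> i)" by (simp add: \<phi>_def)
  qed
  ultimately show ?thesis unfolding descending_ordering_def by blast
qed

lemma UB3_choice_exists:
  assumes "simple_graph V E"
  shows "\<exists>D \<phi>. UB3_choice V E c k D \<phi>"
proof -
  have "\<forall>u. \<exists>S. heaviest_edges E c (k - 1) u S"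
    using heaviest_edges_exist[OF assms] by blast
  then obtain D where "\<forall>u. heaviest_edges E c (k - 1) u (D u)"
    by (rule choice[THEN exE])
  moreover obtain \<phi> where "descending_ordering V (eta c D) \<phi>"
    using descending_ordering_exists[of V "eta c D"] assms by (auto simp: simple_graph_def)
  ultimately show ?thesis unfolding UB3_choice_def by blast
qed


text \<open>The color classes of the \<open>k\<close>-th instance are numbered by \<open>i < k\<close>, and the vertex
  \<open>v\<^bsub>I,J\<^esub>\<close> labeled by the \<open>i\<close>-th and \<open>j\<close>-th class is the pair \<open>(i, j)\<close>.\<close>

definition class4 :: "nat \<Rightarrow> nat \<Rightarrow> (nat \<times> nat) set" where
  "class4 k i = {(i, j) | j. j < k \<and> j \<noteq> i}"

definition coloring4 :: "nat \<Rightarrow> (nat \<times> nat) set set" where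
  "coloring4 k = class4 k ` {..<k}"

definition verts4 :: "nat \<Rightarrow> (nat \<times> nat) set" where
  "verts4 k = \<Union> (coloring4 k)"

definition edges4 :: "nat \<Rightarrow> (nat \<times> nat) set set" where
  "edges4 k = {{u, v} | u v. \<exists>I\<in>coloring4 k. \<exists>J\<in>coloring4 k. I \<noteq> J \<and> u \<in> I \<and> v \<in> J}"

definition weight4 :: "nat \<Rightarrow> (nat \<times> nat) set \<Rightarrow> nat" where
  "weight4 k e = (if \<exists>i<k. \<exists>j<k. i \<noteq> j \<and> e = {(i, j), (j, i)} then 1 else 0)"


text \<open>The instances are as required: \<open>k\<close> color classes of \<open>k - 1\<close> vertices each, and \<open>k\<close> is
  an admissible parameter of the third bound.\<close>

lemma class4_eq: "class4 k i = Pair i ` ({..<k} - {i})"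
  by (auto simp: class4_def)

lemma card_class4: "i < k \<Longrightarrow> card (class4 k i) = k - 1"
  by (simp add: class4_eq card_image inj_on_def)

lemma class4_nonempty:
  assumes "k \<ge> 2" shows "class4 k i \<noteq> {}"
proof -
  have "0 < k \<and> 1 < k" using assms by simp
  then show ?thesis by (cases "i = 0") (auto simp: class4_def)
qed

lemma inj_class4:
  assumes "k \<ge> 2" shows "inj_on (class4 k) A"
proof (rule inj_onI)
  fix i j assume eq: "class4 k i = class4 k j"
  obtain x where "x \<in> class4 k i" using class4_nonempty[OF assms] by blast
  then have "x \<in> class4 k i" "x \<in> class4 k j" using eq by auto
  then show "i = j" by (auto simp: class4_def)
qed

lemma card_coloring4: "k \<ge> 2 \<Longrightarrow> card (coloring4 k) = k"
  by (simp add: coloring4_def card_image inj_class4)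

lemma partition_on_coloring4:
  assumes "k \<ge> 2" shows "partition_on (verts4 k) (coloring4 k)"
proof (rule partition_onI)
  show "\<Union> (coloring4 k) = verts4 k" by (simp add: verts4_def)
  show "{} \<notin> coloring4 k"
    using class4_nonempty[OF assms] by (auto simp: coloring4_def)
  show "disjnt p q" if "p \<in> coloring4 k" "q \<in> coloring4 k" "p \<noteq> q" for p q
    using that by (auto simp: coloring4_def class4_def disjnt_def)
qed

lemma edges4_class_neq:
  assumes "{u, v} \<in> edges4 k" shows "fst u \<noteq> fst v"
  using assms by (auto simp: edges4_def coloring4_def class4_def doubleton_eq_iff)

lemma coloring_coloring4:
  assumes "k \<ge> 2" shows "coloring (verts4 k) (edges4 k) (coloring4 k)"
  unfolding coloring_def independent_set_def
  using partition_on_coloring4[OF assms]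
  by (auto dest!: edges4_class_neq simp: coloring4_def class4_def)

lemma finite_verts4: "finite (verts4 k)"
  by (auto simp: verts4_def coloring4_def class4_eq)

lemma simple_graph4: "simple_graph (verts4 k) (edges4 k)"
proof -
  have "\<exists>u\<in>verts4 k. \<exists>v\<in>verts4 k. u \<noteq> v \<and> e = {u, v}" if "e \<in> edges4 k" for e
  proof -
    from that obtain u v where uv: "e = {u, v}" "u \<in> verts4 k" "v \<in> verts4 k"
      unfolding edges4_def verts4_def by blast
    moreover have "u \<noteq> v" using that uv edges4_class_neq by blast
    ultimately show ?thesis by blast
  qed
  then show ?thesis by (simp add: simple_graph_def finite_verts4)
qed

lemma card_verts4:
  assumes "k \<ge> 2" shows "card (verts4 k) = k * (k - 1)"
proof -
  have "card (verts4 k) = (\<Sum>I\<in>coloring4 k. card I)"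
    unfolding verts4_def
    using partition_on_coloring4[OF assms]
    by (intro card_Union_disjoint)
      (auto simp: partition_on_def coloring4_def class4_eq)
  also have "\<dots> = (\<Sum>I\<in>coloring4 k. k - 1)"
    by (intro sum.cong) (auto simp: coloring4_def card_class4)
  finally show ?thesis by (simp add: card_coloring4[OF assms])
qed

lemma card_clique4:
  assumes "clique (verts4 k) (edges4 k) K" shows "card K \<le> k"
proof -
  have "inj_on fst K"
    using assms edges4_class_neq by (force simp: clique_def inj_on_def)
  moreover have "fst ` K \<subseteq> {..<k}"
    using assms by (auto simp: clique_def verts4_def coloring4_def class4_def)
  ultimately show ?thesis
    using card_inj_on_le[of fst K "{..<k}"] by simp
qed

end

theory Submission
  imports Defs
begin

text \<open>For \<open>k \<ge> 2\<close> both bounds can be computed exactly. The single positive edge at the vertex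
  \<open>(i, j)\<close> is the matching edge to \<open>(j, i)\<close>.

  For the second bound, \<open>\<sigma>\<close> at \<open>(i, j)\<close> therefore is \<open>1\<close> if class \<open>j\<close> precedes class \<open>i\<close>, and
  \<open>0\<close> otherwise (lemma \<open>sigma4\<close>). As class \<open>i\<close> has a vertex labeled by every other class, its
  maximum of \<open>\<sigma>\<close> is \<open>1\<close> as soon as some class precedes it. Only the first class
  has no predecessor, so the bound is \<open>k - 1\<close> whatever the order (lemma \<open>UB2_4\<close>).

  For the third bound, the matching edge is among any \<open>k - 1 \<ge> 1\<close> heaviest edges at its endpoint, so
  \<open>\<eta>\<close> is constantly \<open>1/2\<close> and the bound is \<open>k/2\<close> whatever the choices (lemma \<open>UB3_4\<close>).

  The quotient is thus \<open>2 - 2/k\<close>. The factor \<open>2\<close> arises because the third bound gives each endpoint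
  half of an edge and has only \<open>k\<close> endpoints to add up, whereas the second gives the whole edge to
  the later endpoint, and almost every class contains such an endpoint.\<close>

lemma verts4_iff: "(i, j) \<in> verts4 k \<longleftrightarrow> i < k \<and> j < k \<and> i \<noteq> j"
  by (auto simp: verts4_def coloring4_def class4_def)

text \<open>The edges of weight \<open>1\<close> form a matching, so fixing an endpoint fixes the edge.\<close>

lemma weight4_incident:
  assumes "(i, j) \<in> verts4 k" "(i, j) \<in> e"
  shows "weight4 k e = (if e = {(i, j), (j, i)} then 1 else 0)"
  using assms by (auto simp: weight4_def verts4_iff)

lemma matching_edge_incident:
  assumes "(i, j) \<in> verts4 k"
  shows "{(i, j), (j, i)} \<in> incident_edges (edges4 k) (i, j)"
proof -
  have ij: "i < k" "j < k" "i \<noteq> j" using assms by (auto simp: verts4_iff)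
  then have "(i, j) \<in> class4 k i" "(j, i) \<in> class4 k j" "class4 k i \<noteq> class4 k j"
    by (auto simp: class4_def)
  then show ?thesis
    using ij unfolding incident_edges_def edges4_def coloring4_def by blast
qed

lemma color_of_eq:
  assumes "partition_on V C" "I \<in> C" "u \<in> I"
  shows "color_of C u = I"
  unfolding color_of_def
  using assms by (intro the_equality) (auto simp: partition_on_def disjoint_def)

lemma max_or_0_binary:
  assumes "A \<subseteq> {0, 1}"
  shows "max_or_0 A = (if 1 \<in> A then 1 else 0)"
proof -
  have "A \<in> {{}, {0}, {1}, {0, 1}}" using assms by blast
  then show ?thesis by (auto simp: max_or_0_def)
qed

text \<open>Class \<open>j\<close> is the one class that the matching edge at \<open>(i, j)\<close> leads to.\<close>

lemma max_weight4_into_class: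
  assumes u: "(i, j) \<in> verts4 k" and I: "I \<in> coloring4 k"
  shows "max_or_0 {weight4 k e | e v. e = {(i, j), v}
             \<and> e \<in> incident_edges (edges4 k) (i, j) \<and> v \<in> I}
         = (if I = class4 k j then 1 else 0)"
    (is "max_or_0 ?A = _")
proof -
  have weight: "weight4 k {(i, j), v} = (if v = (j, i) then 1 else 0)" for v
    using weight4_incident[OF u, of "{(i, j), v}"] u by (auto simp: verts4_iff doubleton_eq_iff)
  have sub: "?A \<subseteq> {0, 1}"
  proof
    fix w assume "w \<in> ?A"
    then obtain v where "w = weight4 k {(i, j), v}" by blast
    then show "w \<in> {0, 1}" by (simp add: weight)
  qed
  have "1 \<in> ?A \<longleftrightarrow> (j, i) \<in> I"
  proof
    assume "1 \<in> ?A"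
    then obtain v where "1 = weight4 k {(i, j), v}" "v \<in> I" by blast
    then show "(j, i) \<in> I" by (simp add: weight split: if_splits)
  next
    assume "(j, i) \<in> I"
    moreover have "1 = weight4 k {(i, j), (j, i)}" by (simp add: weight)
    ultimately show "1 \<in> ?A" using matching_edge_incident[OF u] by blast
  qed
  also have "\<dots> \<longleftrightarrow> I = class4 k j"
    using I u by (auto simp: coloring4_def class4_def verts4_iff)
  finally show ?thesis by (simp only: max_or_0_binary[OF sub])
qed

lemma sigma4:
  assumes k: "k \<ge> 2" and u: "(i, j) \<in> verts4 k"
  shows "sigma (edges4 k) (weight4 k) (coloring4 k) prec (i, j)
         = (if prec (class4 k j) (class4 k i) then 1 else 0)"
proof -
  have ij: "i < k" "j < k" "i \<noteq> j" using u by (auto simp: verts4_iff)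
  have color: "color_of (coloring4 k) (i, j) = class4 k i"
    using ij by (intro color_of_eq[OF partition_on_coloring4[OF k]])
      (auto simp: coloring4_def class4_def)
  let ?P = "{I \<in> coloring4 k. prec I (class4 k i)}"
  have "sigma (edges4 k) (weight4 k) (coloring4 k) prec (i, j)
      = (\<Sum>I\<in>?P. if I = class4 k j then 1 else 0)"
    unfolding sigma_def color
    by (intro sum.cong refl max_weight4_into_class[OF u]) auto
  also have "\<dots> = (if class4 k j \<in> ?P then 1 else 0)"
    by (simp add: coloring4_def)
  finally show ?thesis using ij by (simp add: coloring4_def)
qed

text \<open>The vertices of a class carry the other classes as labels, so a predecessor of the class is
  the label of a vertex at which \<open>\<sigma>\<close> is \<open>1\<close>.\<close>

lemma Max_sigma4:
  assumes k: "k \<ge> 2" and irrefl: "irreflp_on (coloring4 k) prec" and I: "I \<in> coloring4 k"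
  shows "Max (sigma (edges4 k) (weight4 k) (coloring4 k) prec ` I)
         = (if \<exists>J\<in>coloring4 k. prec J I then 1 else 0)"
proof -
  obtain i where i: "i < k" "I = class4 k i" using I by (auto simp: coloring4_def)
  let ?s = "sigma (edges4 k) (weight4 k) (coloring4 k) prec"
  have s: "?s (i, j) = (if prec (class4 k j) I then 1 else 0)" if "j < k" "j \<noteq> i" for j
    unfolding i(2) using i(1) that by (intro sigma4[OF k]) (simp add: verts4_iff)
  have I_iff: "u \<in> I \<longleftrightarrow> (\<exists>j<k. j \<noteq> i \<and> u = (i, j))" for u
    by (auto simp: i class4_def)
  have sub: "?s ` I \<subseteq> {0, 1}"
  proof (rule image_subsetI)
    fix u assume "u \<in> I"
    then obtain j where "j < k" "j \<noteq> i" "u = (i, j)" by (auto simp: I_iff)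
    then show "?s u \<in> {0, 1}" by (simp add: s)
  qed
  have "?s ` I \<noteq> {}" using class4_nonempty[OF k] i by simp
  then have "Max (?s ` I) = (if 1 \<in> ?s ` I then 1 else 0)"
    using max_or_0_binary[OF sub] by (simp add: max_or_0_def)
  moreover have "1 \<in> ?s ` I \<longleftrightarrow> (\<exists>J\<in>coloring4 k. prec J I)"
  proof
    assume "1 \<in> ?s ` I"
    then obtain u where "1 = ?s u" "u \<in> I" by (rule imageE)
    then obtain j where j: "j < k" "j \<noteq> i" "?s (i, j) = 1" by (auto simp: I_iff)
    then have "prec (class4 k j) I" using s[OF j(1,2)] by presburger
    then show "\<exists>J\<in>coloring4 k. prec J I"
      using j by (auto simp: coloring4_def)
  next
    assume "\<exists>J\<in>coloring4 k. prec J I"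
    then obtain j where j: "j < k" "prec (class4 k j) I" by (auto simp: coloring4_def)
    \<comment> \<open>Irreflexivity excludes \<open>j = i\<close>, so that the vertex \<open>(i, j)\<close> exists.\<close>
    have "j \<noteq> i" using j i irreflp_onD[OF irrefl I] by blast
    then have "1 = ?s (i, j)" "(i, j) \<in> I" using j by (simp_all add: I_iff s)
    then show "1 \<in> ?s ` I" by (rule image_eqI)
  qed
  ultimately show ?thesis by simp
qed

text \<open>All elements but the least one have a predecessor.\<close>

lemma card_with_predecessor:
  assumes fin: "finite A" and ne: "A \<noteq> {}" and ord: "strict_total_order_on A prec"
  shows "card {x \<in> A. \<exists>y\<in>A. prec y x} = card A - 1"
proof -
  have irrefl: "irreflp_on A prec" and trans: "transp_on A prec" and total: "totalp_on A prec"
    using ord by (auto simp: strict_total_order_on_def)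
  have "asymp_on A prec"
    by (rule asymp_onI) (meson irrefl trans irreflp_onD transp_onD)
  from Finite_Set.bex_min_element[OF fin this trans ne]
  obtain m where m: "m \<in> A" "\<And>x. x \<in> A \<Longrightarrow> x \<noteq> m \<Longrightarrow> \<not> prec x m" by blast
  have "{x \<in> A. \<exists>y\<in>A. prec y x} = A - {m}"
    using m irrefl total by (fastforce simp: irreflp_on_def totalp_on_def)
  then show ?thesis using m(1) fin by simp
qed

lemma UB2_4:
  assumes k: "k \<ge> 2" and ord: "strict_total_order_on (coloring4 k) prec"
  shows "UB2 (edges4 k) (weight4 k) (coloring4 k) prec = k - 1"
proof -
  have fin: "finite (coloring4 k)" by (simp add: coloring4_def)
  have "irreflp_on (coloring4 k) prec" using ord by (simp add: strict_total_order_on_def)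
  then have "UB2 (edges4 k) (weight4 k) (coloring4 k) prec
      = (\<Sum>I\<in>coloring4 k. if \<exists>J\<in>coloring4 k. prec J I then 1 else 0)"
    unfolding UB2_def by (intro sum.cong refl Max_sigma4[OF k])
  also have "\<dots> = card {I \<in> coloring4 k. \<exists>J\<in>coloring4 k. prec J I}"
    using fin by (simp add: sum.If_cases Int_def)
  also have "\<dots> = card (coloring4 k) - 1"
    using k by (intro card_with_predecessor[OF fin _ ord]) (auto simp: coloring4_def lessThan_empty_iff)
  finally show ?thesis by (simp add: card_coloring4[OF k])
qed

text \<open>A nonempty choice of heaviest edges that left out the strictly heaviest one would contain a
  lighter edge in its place.\<close>

lemma heaviest_edge_in_choice:
  assumes S: "heaviest_edges E c t u S" and t: "t \<ge> 1" and fin: "finite (incident_edges E u)"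
    and m: "m \<in> incident_edges E u"
    and max: "\<And>e. e \<in> incident_edges E u \<Longrightarrow> e \<noteq> m \<Longrightarrow> c e < c m"
  shows "m \<in> S"
proof (rule ccontr)
  assume "m \<notin> S"
  have "card (incident_edges E u) > 0" using fin m by (auto simp: card_gt_0_iff)
  then have "card S > 0" using S t by (simp add: heaviest_edges_def)
  then obtain e where e: "e \<in> S" by fastforce
  then have "c m \<le> c e" "e \<in> incident_edges E u"
    using S m \<open>m \<notin> S\<close> by (auto simp: heaviest_edges_def)
  then show False using max[of e] e \<open>m \<notin> S\<close> by fastforce
qed

lemma finite_incident_edges:
  assumes "simple_graph V E"
  shows "finite (incident_edges E u)"
proof -
  have "incident_edges E u \<subseteq> Pow V" "finite V"
    using assms by (auto simp: simple_graph_def incident_edges_def)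
  then show ?thesis by (auto intro: finite_subset)
qed

lemma eta4:
  assumes k: "k \<ge> 2" and u: "(i, j) \<in> verts4 k"
    and D: "heaviest_edges (edges4 k) (weight4 k) (k - 1) (i, j) (D (i, j))"
  shows "eta (weight4 k) D (i, j) = 1 / 2"
proof -
  let ?m = "{(i, j), (j, i)}"
  note fin = finite_incident_edges[OF simple_graph4, of k "(i, j)"]
  have weight: "weight4 k e = (if e = ?m then 1 else 0)"
    if "e \<in> incident_edges (edges4 k) (i, j)" for e
    using that by (intro weight4_incident[OF u]) (simp add: incident_edges_def)
  have sub: "D (i, j) \<subseteq> incident_edges (edges4 k) (i, j)"
    using D by (simp add: heaviest_edges_def)
  have mem: "?m \<in> D (i, j)"
    using k by (intro heaviest_edge_in_choice[OF D _ fin matching_edge_incident[OF u]])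
      (simp_all add: weight matching_edge_incident[OF u])
  have "(\<Sum>e\<in>D (i, j). real (weight4 k e)) = (\<Sum>e\<in>D (i, j). if e = ?m then 1 else 0)"
    by (intro sum.cong refl) (simp add: weight[OF subsetD[OF sub]])
  also have "\<dots> = 1" using mem finite_subset[OF sub fin] by simp
  finally show ?thesis by (simp add: eta_def)
qed

lemma UB3_4:
  assumes k: "k \<ge> 2" and choice: "UB3_choice (verts4 k) (edges4 k) (weight4 k) k D \<phi>"
  shows "UB3 (weight4 k) k D \<phi> = real k / 2"
proof -
  have eta: "eta (weight4 k) D u = 1 / 2" if "u \<in> verts4 k" for u
    using that choice eta4[OF k, of "fst u" "snd u" D] by (simp add: UB3_choice_def)
  have bij: "bij_betw \<phi> {1..card (verts4 k)} (verts4 k)"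
    using choice by (simp add: UB3_choice_def descending_ordering_def)
  \<comment> \<open>The sum stays within the domain of the ordering, as \<open>k \<le> k * (k - 1)\<close>.\<close>
  have "k \<le> card (verts4 k)" using k by (simp add: card_verts4[OF k])
  then have "\<phi> j \<in> verts4 k" if "j \<in> {1..k}" for j
    using that bij_betwE[OF bij] by auto
  then have "UB3 (weight4 k) k D \<phi> = (\<Sum>j = 1..k. 1 / 2)"
    unfolding UB3_def by (intro sum.cong refl eta)
  then show ?thesis by simp
qed

theorem proposition6:
  fixes prec :: "nat \<Rightarrow> (nat \<times> nat) set \<Rightarrow> (nat \<times> nat) set \<Rightarrow> bool"
    and D :: "nat \<Rightarrow> nat \<times> nat \<Rightarrow> (nat \<times> nat) set set"
    and \<phi> :: "nat \<Rightarrow> nat \<Rightarrow> nat \<times> nat"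
  assumes "\<And>k. k \<ge> 2 \<Longrightarrow> strict_total_order_on (coloring4 k) (prec k)"
    and "\<And>k. k \<ge> 2 \<Longrightarrow> UB3_choice (verts4 k) (edges4 k) (weight4 k) k (D k) (\<phi> k)"
  shows "(\<lambda>k. real (UB2 (edges4 k) (weight4 k) (coloring4 k) (prec k))
              / UB3 (weight4 k) k (D k) (\<phi> k)) \<longlonglongrightarrow> 2"
proof -
  have "(\<lambda>k. 2 - 2 * inverse (real k)) \<longlonglongrightarrow> 2 - 2 * 0"
    by (intro tendsto_intros lim_inverse_n)
  then have "(\<lambda>k. 2 - 2 * inverse (real k)) \<longlonglongrightarrow> 2" by simp
  moreover have "\<forall>\<^sub>F k in sequentially. 2 - 2 * inverse (real k)
      = real (UB2 (edges4 k) (weight4 k) (coloring4 k) (prec k))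
        / UB3 (weight4 k) k (D k) (\<phi> k)"
    using eventually_ge_at_top[of 2]
  proof eventually_elim
    case (elim k)
    show ?case
      unfolding UB2_4[OF elim assms(1)[OF elim]] UB3_4[OF elim assms(2)[OF elim]]
      using elim by (simp add: of_nat_diff field_simps)
  qed
  ultimately show ?thesis by (rule Lim_transform_eventually)
qed

end
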